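(* Let $j, k \in \mathbb{N}^+$ with $k > j$. Then $$B_{2k+j,k} = (k+j+3)\,2^{k+j-2} - (3j^2+19j+18)\,2^{j-4}.$$
   Context: For $n,k\in\mathbb{N}^+$, $B_{n,k}$ denotes the number of ways to split $n$ indistinguishable balls into any number of nonempty, ordered bins so that the most crowded bin contains exactly $k$ balls; equivalently, the number of compositions $(x_1,\dots,x_\ell)$ of $n$ (ordered tuples of positive integers of any length $\ell\ge 1$ summing to $n$) with $\max_i x_i = k$. *)

theory Defs
  imports Complex_Main
begin

definition compositions :: "nat \<Rightarrow> nat list set" where
  "compositions n = {xs. xs \<noteq> [] \<and> (\<forall>x\<in>set xs. 0 < x) \<and> sum_list xs = n}"

definition B :: "nat \<Rightarrow> nat \<Rightarrow> nat" where
  "B n k = card {xs \<in> compositions n. Max (set xs) = k}"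

(* Finiteness, so that card in the definition of B is a genuine count. *)
lemma finite_compositions: "finite (compositions n)"
proof (rule finite_subset)
  show "compositions n \<subseteq> {xs. set xs \<subseteq> {..n} \<and> length xs \<le> n}"
  proof
    fix xs assume "xs \<in> compositions n"
    then have pos: "\<forall>x\<in>set xs. 0 < x" and sum: "sum_list xs = n"
      by (auto simp: compositions_def)
    have "length xs \<le> sum_list xs"
      using pos by (induction xs) auto
    moreover have "set xs \<subseteq> {..n}"
      using member_le_sum_list sum by auto
    ultimately show "xs \<in> {xs. set xs \<subseteq> {..n} \<and> length xs \<le> n}"
      using sum by simp
  qed
  show "finite {xs. set xs \<subseteq> {..n} \<and> length xs \<le> n}"
    by (rule finite_lists_length_le) simp
qed

end

theory Submission
  imports Defs
begin

text \<open>Let \<open>c m n\<close> count the compositions of \<open>n\<close> into parts of size at most \<open>m\<close>, so that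
  \<open>B n k = c k n - c (k - 1) n\<close>. Splitting off the first part and comparing consecutive values gives
  \<open>c m (n + 1) + c m (n - m) = 2 * c m n\<close> for \<open>n \<ge> m \<ge> 1\<close>. Equivalently, the generating function is
  \<open>(1 - x) / (1 - 2x + x^(m+1))\<close>, the sum over \<open>r\<close> of
  \<open>(-1)^r (1 - x) x^(r(m+1)) / (1 - 2x)^(r+1)\<close>. Only the terms with \<open>r \<le> 2\<close> contribute
  below \<open>n = 3m + 3\<close>, which covers \<open>n = 2k + j\<close> for both \<open>m = k\<close> and \<open>m = k - 1\<close>.\<close>

definition bounded_compositions :: "nat \<Rightarrow> nat \<Rightarrow> nat list set" where
  "bounded_compositions m n = {xs. (\<forall>x\<in>set xs. 0 < x \<and> x \<le> m) \<and> sum_list xs = n}"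

abbreviation num_bounded :: "nat \<Rightarrow> nat \<Rightarrow> nat" where
  "num_bounded m n \<equiv> card (bounded_compositions m n)"

lemma bounded_compositions_0: "bounded_compositions m 0 = {[]}"
proof -
  have "xs = []" if "\<forall>x\<in>set xs. 0 < x \<and> x \<le> m" "sum_list xs = 0" for xs :: "nat list"
    using that by (cases xs) auto
  then show ?thesis
    by (auto simp: bounded_compositions_def)
qed

lemma finite_bounded_compositions: "finite (bounded_compositions m n)"
proof (cases n)
  case 0
  then show ?thesis by (simp add: bounded_compositions_0)
next
  case (Suc n')
  then have "bounded_compositions m n \<subseteq> compositions n"
    by (auto simp: bounded_compositions_def compositions_def)
  then show ?thesis
    using finite_compositions finite_subset by blast
qed

lemma bounded_compositions_Suc:
  "bounded_compositions m (Suc n) =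
    (\<Union>i\<in>{..<min m (Suc n)}. (#) (Suc i) ` bounded_compositions m (n - i))"
  (is "?L = ?R")
proof
  show "?L \<subseteq> ?R"
  proof
    fix xs assume xs: "xs \<in> ?L"
    then obtain x ys where [simp]: "xs = x # ys"
      by (cases xs) (auto simp: bounded_compositions_def)
    from xs obtain i where [simp]: "x = Suc i"
      by (cases x) (auto simp: bounded_compositions_def)
    from xs have "i < min m (Suc n)" "ys \<in> bounded_compositions m (n - i)"
      by (auto simp: bounded_compositions_def)
    then show "xs \<in> ?R" by auto
  qed
  show "?R \<subseteq> ?L"
    by (auto simp: bounded_compositions_def)
qed

lemma num_bounded_Suc: "num_bounded m (Suc n) = (\<Sum>i<min m (Suc n). num_bounded m (n - i))"
  unfolding bounded_compositions_Suc
  by (subst card_UN_disjoint) (auto simp: finite_bounded_compositions card_image)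

lemma num_bounded_0 [simp]: "num_bounded m 0 = 1"
  by (simp add: bounded_compositions_0)

text \<open>The bound \<open>m\<close> excludes nothing here. The sum for \<open>Suc (Suc n)\<close>
  is that for \<open>Suc n\<close> with one extra term, equal to the sum itself, so the count
  doubles.\<close>

lemma num_bounded_small: "n < m \<Longrightarrow> num_bounded m (Suc n) = 2 ^ n"
proof (induction n)
  case 0
  then show ?case by (simp add: num_bounded_Suc)
next
  case (Suc n)
  then have "num_bounded m (Suc (Suc n)) = num_bounded m (Suc n) + (\<Sum>i<Suc n. num_bounded m (n - i))"
    unfolding num_bounded_Suc[of m "Suc n"]
    by (simp only: min_absorb2 Suc_leI sum.lessThan_Suc_shift) simp
  moreover have "num_bounded m (Suc n) = (\<Sum>i<Suc n. num_bounded m (n - i))"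
    unfolding num_bounded_Suc using Suc.prems by (simp only: min_absorb2)
  ultimately show ?case
    using Suc by simp
qed

text \<open>The counts at \<open>m + t + 1\<close> and \<open>m + t\<close> are sums over windows of
  \<open>m\<close> preceding values. The windows differ only in that the first contains the value at
  \<open>m + t\<close> and the second the value at \<open>t\<close>.\<close>

lemma num_bounded_rec:
  assumes "0 < m"
  shows "num_bounded m (Suc (m + t)) + num_bounded m t = 2 * num_bounded m (m + t)"
proof -
  obtain l where [simp]: "m = Suc l"
    using assms gr0_conv_Suc by blast
  have "num_bounded m (Suc (m + t)) = num_bounded m (m + t) + (\<Sum>i<l. num_bounded m (l + t - i))"
    unfolding num_bounded_Suc[of m "m + t"]
    by (simp add: sum.lessThan_Suc_shift del: sum.lessThan_Suc)
  moreover have "num_bounded m (m + t) = (\<Sum>i<l. num_bounded m (l + t - i)) + num_bounded m t"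
    using num_bounded_Suc[of m "l + t"] by simp
  ultimately show ?thesis by simp
qed

text \<open>In this range only \<open>r = 0\<close> and \<open>r = 1\<close> contribute; the latter
  subtracts the coefficient of x^t in (1 - x) / (1 - 2x)^2.\<close>

lemma num_bounded_medium:
  assumes "0 < m" "t \<le> m"
  shows "real (num_bounded m (Suc m + t)) = 2 ^ (m + t) - (real t + 2) * 2 ^ t / 2"
  using assms(2)
proof (induction t)
  case 0
  obtain l where l: "m = Suc l"
    using assms(1) gr0_conv_Suc by blast
  have "num_bounded m m = 2 ^ l"
    using num_bounded_small[of l m] l by simp
  then have "num_bounded m (Suc m) + 1 = 2 ^ m"
    using num_bounded_rec[of m 0] assms l by simp
  then have "real (num_bounded m (Suc m) + 1) = 2 ^ m"
    by simp
  then show ?case by simp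
next
  case (Suc t)
  have "num_bounded m (Suc m + Suc t) + 2 ^ t = 2 * num_bounded m (Suc m + t)"
    using num_bounded_rec[of m "Suc t"] num_bounded_small[of t m] assms Suc.prems by simp
  then have "real (num_bounded m (Suc m + Suc t) + 2 ^ t) = real (2 * num_bounded m (Suc m + t))"
    by (rule arg_cong)
  then have "real (num_bounded m (Suc m + Suc t)) = 2 * real (num_bounded m (Suc m + t)) - 2 ^ t"
    by (simp only: of_nat_add of_nat_mult of_nat_power of_nat_numeral)
  also have "\<dots> = 2 ^ (m + Suc t) - (real (Suc t) + 2) * 2 ^ Suc t / 2"
    using Suc by (simp add: field_simps)
  finally show ?case .
qed

text \<open>The summand with denominator 4 comes from \<open>r = 2\<close>: it is the coefficient of
  x^s in (1 - x) / (1 - 2x)^3.\<close>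

lemma num_bounded_large:
  assumes "0 < m" "s \<le> m"
  shows "real (num_bounded m (2 * m + 2 + s)) =
    2 ^ (2 * m + 1 + s) - (real m + real s + 3) * 2 ^ (m + s)
      + ((real s)\<^sup>2 + 5 * real s + 4) * 2 ^ s / 4"
  using assms(2)
proof (induction s)
  case 0
  \<comment> \<open>Both values on the right come from the medium range, at its two ends
    \<open>t = m\<close> and \<open>t = 0\<close>.\<close>
  have "num_bounded m (2 * m + 2) + num_bounded m (Suc m + 0) = 2 * num_bounded m (Suc m + m)"
    using num_bounded_rec[of m "Suc m"] assms by (simp add: mult_2)
  then have "real (num_bounded m (2 * m + 2) + num_bounded m (Suc m + 0))
      = real (2 * num_bounded m (Suc m + m))"
    by (rule arg_cong)
  then have "real (num_bounded m (2 * m + 2))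
      = 2 * real (num_bounded m (Suc m + m)) - real (num_bounded m (Suc m + 0))"
    by (simp only: of_nat_add of_nat_mult of_nat_numeral)
  also have "\<dots> = 2 ^ (2 * m + 1) - (real m + 3) * 2 ^ m + 1"
    using num_bounded_medium[of m m] num_bounded_medium[of m 0] assms
    by (simp add: mult_2_right[of m, symmetric] field_simps)
  finally show ?case by simp
next
  case (Suc s)
  \<comment> \<open>The value that the recurrence subtracts is in the medium range, with
    \<open>t = Suc s\<close>.\<close>
  have "num_bounded m (2 * m + 2 + Suc s) + num_bounded m (Suc m + Suc s)
      = 2 * num_bounded m (2 * m + 2 + s)"
    using num_bounded_rec[of m "Suc m + Suc s"] assms by (simp add: mult_2 add.assoc)
  then have "real (num_bounded m (2 * m + 2 + Suc s) + num_bounded m (Suc m + Suc s))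
      = real (2 * num_bounded m (2 * m + 2 + s))"
    by (rule arg_cong)
  then have "real (num_bounded m (2 * m + 2 + Suc s))
      = 2 * real (num_bounded m (2 * m + 2 + s)) - real (num_bounded m (Suc m + Suc s))"
    by (simp only: of_nat_add of_nat_mult of_nat_numeral)
  also have "\<dots> = 2 ^ (2 * m + 1 + Suc s) - (real m + real (Suc s) + 3) * 2 ^ (m + Suc s)
      + ((real (Suc s))\<^sup>2 + 5 * real (Suc s) + 4) * 2 ^ Suc s / 4"
    using Suc num_bounded_medium[OF assms(1) Suc.prems]
    by (simp add: field_simps power2_eq_square)
  finally show ?case .
qed

lemma B_eq_diff:
  assumes "0 < n"
  shows "B n (Suc m) + num_bounded m n = num_bounded (Suc m) n"
proof -
  let ?X = "{xs \<in> compositions n. Max (set xs) = Suc m}"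
  have "bounded_compositions (Suc m) n = ?X \<union> bounded_compositions m n"
  proof (intro set_eqI)
    fix xs
    \<comment> \<open>As \<open>n\<close> is positive, the empty list lies in neither set, so only
      maxima of nonempty sets matter.\<close>
    have "xs \<in> bounded_compositions l n \<longleftrightarrow> xs \<in> compositions n \<and> Max (set xs) \<le> l" for l
      using assms by (cases "xs = []") (auto simp: bounded_compositions_def compositions_def)
    then show "xs \<in> bounded_compositions (Suc m) n \<longleftrightarrow> xs \<in> ?X \<union> bounded_compositions m n"
      by (auto simp: le_Suc_eq)
  qed
  moreover have "?X \<inter> bounded_compositions m n = {}"
  proof -
    have "xs \<notin> bounded_compositions m n" if "xs \<in> ?X" for xs
    proof -
      from that have "Suc m \<in> set xs"
        by (metis (mono_tags, lifting) Max_in List.finite_set compositions_def mem_Collect_eq set_empty)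
      then show ?thesis
        by (fastforce simp: bounded_compositions_def)
    qed
    then show ?thesis by blast
  qed
  moreover have "finite ?X"
    using finite_compositions by simp
  ultimately show ?thesis
    by (simp add: B_def card_Un_disjoint finite_bounded_compositions)
qed

theorem mainTheorem3:
  fixes j k :: nat
  assumes "1 \<le> j" and "1 \<le> k" and "j < k"
  shows "real (B (2 * k + j) k) =
    (real k + real j + 3) * 2 powi (int k + int j - 2)
      - (3 * (real j)\<^sup>2 + 19 * real j + 18) * 2 powi (int j - 4)"
proof -
  obtain m where m: "k = Suc m" "0 < m" "j \<le> m"
    using assms by (cases k) auto
  \<comment> \<open>Here 2k + j = 2m + 2 + j, so \<open>s = j\<close>.\<close>
  have lower: "real (num_bounded m (2 * k + j)) = 2 ^ (2 * k + j) / 2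
      - (real k + real j + 2) * 2 ^ (k + j) / 2 + ((real j)\<^sup>2 + 5 * real j + 4) * 2 ^ j / 4"
    using num_bounded_large[OF m(2,3)] m(1) by (simp add: field_simps)
  have upper: "real (num_bounded k (2 * k + j)) = 2 ^ (2 * k + j) / 2
      - (real k + real j + 1) * 2 ^ (k + j) / 4 + ((real j)\<^sup>2 + real j - 2) * 2 ^ j / 16"
  \<comment> \<open>With bound \<open>k\<close> the large range needs \<open>s = j - 2\<close>. For
    \<open>j = 1\<close> the argument is 2k + 1, the end \<open>t = k\<close> of the medium range;
    the formula persists because j^2 + j - 2 = (j - 1)(j + 2) vanishes.\<close>
  proof (cases "j = 1")
    case True
    then show ?thesis
      using num_bounded_medium[of k k] assms by (simp add: mult_2_right[of k, symmetric] field_simps)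
  next
    case False
    then obtain s where s: "j = s + 2"
      using assms(1) by (metis add.commute le_Suc_ex le_antisym not_less_eq_eq one_add_one plus_1_eq_Suc)
    then have "real (num_bounded k (2 * k + j)) = 2 ^ (2 * k + 1 + s)
        - (real k + real s + 3) * 2 ^ (k + s) + ((real s)\<^sup>2 + 5 * real s + 4) * 2 ^ s / 4"
      using num_bounded_large[of k s] assms by (simp add: ac_simps)
    then show ?thesis
      unfolding s by (simp add: power_add) (simp add: algebra_simps power2_eq_square)
  qed
  have "real (B (2 * k + j) k) = real (num_bounded k (2 * k + j)) - real (num_bounded m (2 * k + j))"
    using B_eq_diff[of "2 * k + j" m] m(1) by simp
  also have "\<dots> = (real k + real j + 3) * (2 ^ (k + j) / 4)
      - (3 * (real j)\<^sup>2 + 19 * real j + 18) * (2 ^ j / 16)"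
    unfolding lower upper by (simp add: field_simps)
  also have "2 ^ (k + j) / 4 = (2 powi (int k + int j - 2) :: real)"
    by (simp add: power_int_diff power_int_add power_add)
  also have "2 ^ j / 16 = (2 powi (int j - 4) :: real)"
    by (simp add: power_int_diff)
  finally show ?thesis .
qed

end
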